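(* Let $\rho\in[0,1]$, $n\in\mathbb N$. If a learning rule $A$ over a domain $\mathcal X$ is $n$-sample $\rho$-replicable, then it is also $n$-sample $\rho$-TV indistinguishable.
   Context: An $n$-sample learning rule is a randomized map $A:(\mathcal X\times\{0,1\})^n\to\{0,1\}^{\mathcal X}$; $A(S)$ denotes the probability distribution of its output on input $S$. It can be implemented as a learning algorithm, i.e. a deterministic map $A:(\mathcal X\times\{0,1\})^n\times\mathcal R\to\{0,1\}^{\mathcal X}$, where $r\sim\mathcal R$ is the internal randomness ($\mathcal R$ denotes both a probability space and its distribution), so that $A(S)$ is the law of $A(S,r)$ for $r\sim\mathcal R$. $A$ is $n$-sample $\rho$-replicable if for every distribution $\mathcal D$ over $\mathcal X\times\{0,1\}$, $\Pr_{S,S'\sim\mathcal D^n,\ r\sim\mathcal R}[A(S,r)\neq A(S',r)]\le\rho$, where $S,S',r$ are independent. $A$ is $n$-sample $\rho$-TV indistinguishable if for every distribution $\mathcal D$ over $\mathcal X\times\{0,1\}$ and independent $S,S'\sim\mathcal D^n$, $\mathbf E_{S,S'}[d_{\mathrm{TV}}(A(S),A(S'))]\le\rho$, where $d_{\mathrm{TV}}$ is total variation distance, $d_{\mathrm{TV}}(P,Q)=\sup_E (P(E)-Q(E))$. *)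

theory Defs
  imports "HOL-Probability.Probability"
begin

text \<open>
  The domain is an arbitrary measurable space \<open>X\<close>, and \<open>{0,1}\<^sup>X\<close> carries an arbitrary
  sigma-algebra: \<open>H\<close> is any measure with \<open>space H = space X \<rightarrow>\<^sub>E UNIV\<close>. Only the underlying
  measurable spaces of \<open>X\<close> and \<open>H\<close> matter, not their measures.

  Neither the event \<open>A(S,r) \<noteq> A(S',r)\<close> nor the map \<open>(S,S') \<mapsto> d\<^sub>T\<^sub>V(A(S),A(S'))\<close> need be
  measurable at this level of generality. Rather than assuming that they are, the probability is
  read as an outer probability and the expectation as an upper integral; these are the usual
  probability and expectation whenever the latter are defined (\<open>outer_measure_of_eq\<close> in the library
  and \<open>upper_nn_integral_eq\<close>, \<open>upper_expectation_le_iff\<close> below).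
\<close>

definition examples :: "'x measure \<Rightarrow> ('x \<times> bool) measure" where
  "examples X = X \<Otimes>\<^sub>M count_space UNIV"

abbreviation iid :: "nat \<Rightarrow> 'z measure \<Rightarrow> (nat \<Rightarrow> 'z) measure" where
  "iid n D \<equiv> PiM {..<n} (\<lambda>_. D)"

definition example_distribution :: "'x measure \<Rightarrow> ('x \<times> bool) measure \<Rightarrow> bool" where
  "example_distribution X D \<longleftrightarrow> prob_space D \<and> sets D = sets (examples X)"

definition learning_algorithm ::
  "nat \<Rightarrow> 'x measure \<Rightarrow> ('x \<Rightarrow> bool) measure \<Rightarrow> 'r measure \<Rightarrow>
    ((nat \<Rightarrow> 'x \<times> bool) \<Rightarrow> 'r \<Rightarrow> ('x \<Rightarrow> bool)) \<Rightarrow> bool" where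
  "learning_algorithm n X H R A \<longleftrightarrow>
     space H = (space X \<rightarrow>\<^sub>E UNIV) \<and> prob_space R \<and>
     (\<forall>S\<in>space (iid n (examples X)). A S \<in> R \<rightarrow>\<^sub>M H)"

definition learning_rule ::
  "('x \<Rightarrow> bool) measure \<Rightarrow> 'r measure \<Rightarrow> ((nat \<Rightarrow> 'x \<times> bool) \<Rightarrow> 'r \<Rightarrow> ('x \<Rightarrow> bool)) \<Rightarrow>
    (nat \<Rightarrow> 'x \<times> bool) \<Rightarrow> ('x \<Rightarrow> bool) measure" where
  "learning_rule H R A S = distr R H (A S)"

definition tv_dist :: "'a measure \<Rightarrow> 'a measure \<Rightarrow> real" where
  "tv_dist P Q = (SUP E\<in>sets P. measure P E - measure Q E)"

definition upper_nn_integral :: "'a measure \<Rightarrow> ('a \<Rightarrow> ennreal) \<Rightarrow> ennreal" where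
  "upper_nn_integral M f =
     (INF g\<in>{g \<in> borel_measurable M. \<forall>x\<in>space M. f x \<le> g x}. \<integral>\<^sup>+x. g x \<partial>M)"

lemma upper_nn_integral_eq:
  assumes "f \<in> borel_measurable M"
  shows "upper_nn_integral M f = (\<integral>\<^sup>+x. f x \<partial>M)"
  unfolding upper_nn_integral_def
proof (rule antisym)
  show "(INF g\<in>{g \<in> borel_measurable M. \<forall>x\<in>space M. f x \<le> g x}. \<integral>\<^sup>+x. g x \<partial>M) \<le> (\<integral>\<^sup>+x. f x \<partial>M)"
    by (rule INF_lower) (use assms in auto)
  show "(\<integral>\<^sup>+x. f x \<partial>M) \<le> (INF g\<in>{g \<in> borel_measurable M. \<forall>x\<in>space M. f x \<le> g x}. \<integral>\<^sup>+x. g x \<partial>M)"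
    by (rule INF_greatest) (auto intro!: nn_integral_mono)
qed

lemma upper_expectation_le_iff:
  assumes "integrable M f" "\<And>x. x \<in> space M \<Longrightarrow> 0 \<le> f x" "0 \<le> c"
  shows "upper_nn_integral M (\<lambda>x. ennreal (f x)) \<le> ennreal c \<longleftrightarrow> (\<integral>x. f x \<partial>M) \<le> c"
proof -
  have "upper_nn_integral M (\<lambda>x. ennreal (f x)) = (\<integral>\<^sup>+x. ennreal (f x) \<partial>M)"
    using assms(1) by (intro upper_nn_integral_eq) auto
  also have "\<dots> = ennreal (\<integral>x. f x \<partial>M)"
    using assms(1,2) by (intro nn_integral_eq_integral AE_I2)
  finally show ?thesis
    using assms(3) by simp
qed

definition replicable ::
  "nat \<Rightarrow> real \<Rightarrow> 'x measure \<Rightarrow> 'r measure \<Rightarrow>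
    ((nat \<Rightarrow> 'x \<times> bool) \<Rightarrow> 'r \<Rightarrow> ('x \<Rightarrow> bool)) \<Rightarrow> bool" where
  "replicable n \<rho> X R A \<longleftrightarrow>
     (\<forall>D. example_distribution X D \<longrightarrow>
        (let P = iid n D \<Otimes>\<^sub>M iid n D \<Otimes>\<^sub>M R
         in outer_measure_of P {(S, S', r) \<in> space P. A S r \<noteq> A S' r} \<le> ennreal \<rho>))"

definition tv_indistinguishable ::
  "nat \<Rightarrow> real \<Rightarrow> 'x measure \<Rightarrow>
    ((nat \<Rightarrow> 'x \<times> bool) \<Rightarrow> ('x \<Rightarrow> bool) measure) \<Rightarrow> bool" where
  "tv_indistinguishable n \<rho> X K \<longleftrightarrow>
     (\<forall>D. example_distribution X D \<longrightarrow>
        upper_nn_integral (iid n D \<Otimes>\<^sub>M iid n D) (\<lambda>(S, S'). ennreal (tv_dist (K S) (K S')))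
          \<le> ennreal \<rho>)"

end

theory Submission
  imports Defs
begin

text \<open>
  For each event \<open>E\<close>, the difference of the probabilities that \<open>A(S,r)\<close> and \<open>A(S',r)\<close> fall into \<open>E\<close>
  is at most the probability that exactly the first does, which forces \<open>A(S,r) \<noteq> A(S',r)\<close>: using
  the same randomness \<open>r\<close> on both samples is a coupling of \<open>A(S)\<close> and \<open>A(S')\<close>. Averaging over the
  samples gives the claim. As the disagreement event may fail to be measurable, it is replaced by
  a measurable superset of the same outer probability, whose sections in \<open>r\<close> have measurable
  probability and dominate the total variation distance.
\<close>

text \<open>The disagreement set of \<open>f\<close> and \<open>g\<close> may fail to be measurable,
  so the bound is stated for a measurable \<open>B\<close> that contains it.\<close>

lemma tv_dist_distr_le_coupling:
  assumes "prob_space R" and f: "f \<in> R \<rightarrow>\<^sub>M H" and g: "g \<in> R \<rightarrow>\<^sub>M H"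
    and B: "B \<in> sets R" and neq: "\<And>r. r \<in> space R \<Longrightarrow> f r \<noteq> g r \<Longrightarrow> r \<in> B"
  shows "tv_dist (distr R H f) (distr R H g) \<le> measure R B"
  unfolding tv_dist_def
proof (rule cSUP_least)
  interpret prob_space R by fact
  \<comment> \<open>The supremum is over reals, where an upper bound of all members bounds it only
    for a nonempty family.\<close>
  show "sets (distr R H f) \<noteq> {}"
    using sets.empty_sets by blast
  fix E assume "E \<in> sets (distr R H f)"
  then have E: "E \<in> sets H" by simp
  have mf: "f -` E \<inter> space R \<in> sets R" and mg: "g -` E \<inter> space R \<in> sets R"
    using f g E by (auto intro: measurable_sets)
  \<comment> \<open>If \<open>f r\<close> lies in \<open>E\<close>, then either
    \<open>g r = f r\<close> lies in \<open>E\<close> too, or the values differ and \<open>r\<close>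
    is in \<open>B\<close>.\<close>
  have "measure R (f -` E \<inter> space R) \<le> measure R ((g -` E \<inter> space R) \<union> B)"
    using mg B neq by (intro finite_measure_mono) force+
  also have "\<dots> \<le> measure R (g -` E \<inter> space R) + measure R B"
    using mg B by (rule measure_Un_le)
  finally show "measure (distr R H f) E - measure (distr R H g) E \<le> measure R B"
    using f g E by (simp add: measure_distr)
qed

lemma sets_section:
  assumes "B \<in> sets (M \<Otimes>\<^sub>M N \<Otimes>\<^sub>M R)" "x \<in> space M" "y \<in> space N"
  shows "{r \<in> space R. (x, y, r) \<in> B} \<in> sets R"
proof -
  have "Pair y -` (Pair x -` B) \<in> sets R"
    using assms(1) by (intro sets_Pair1)
  moreover have "{r \<in> space R. (x, y, r) \<in> B} = Pair y -` (Pair x -` B)"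
    using sets.sets_into_space[OF assms(1)] by (auto simp: space_pair_measure)
  ultimately show ?thesis
    by simp
qed

text \<open>This is Tonelli for the indicator of \<open>B\<close>, arranged so that the first two
  coordinates are fixed together and only the third is integrated inside, although the triple
  product is nested to the right.\<close>

lemma
  assumes R: "sigma_finite_measure R" and N: "sigma_finite_measure N"
    and B: "B \<in> sets (M \<Otimes>\<^sub>M N \<Otimes>\<^sub>M R)"
  shows borel_measurable_emeasure_section:
      "(\<lambda>(x, y). emeasure R {r \<in> space R. (x, y, r) \<in> B}) \<in> borel_measurable (M \<Otimes>\<^sub>M N)"
    and nn_integral_emeasure_section:
      "(\<integral>\<^sup>+(x, y). emeasure R {r \<in> space R. (x, y, r) \<in> B} \<partial>(M \<Otimes>\<^sub>M N)) = emeasure (M \<Otimes>\<^sub>M N \<Otimes>\<^sub>M R) B"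
proof -
  interpret R: sigma_finite_measure R by fact
  interpret N: sigma_finite_measure N by fact
  interpret NR: pair_sigma_finite N R ..
  let ?i = "\<lambda>x y r. indicator B (x, y, r) :: ennreal"
  have sect: "emeasure R {r \<in> space R. (x, y, r) \<in> B} = (\<integral>\<^sup>+r. ?i x y r \<partial>R)"
    if "x \<in> space M" "y \<in> space N" for x y
  proof -
    have "{r \<in> space R. (x, y, r) \<in> B} \<in> sets R"
      using B that by (rule sets_section)
    then have "emeasure R {r \<in> space R. (x, y, r) \<in> B}
        = (\<integral>\<^sup>+r. indicator {r \<in> space R. (x, y, r) \<in> B} r \<partial>R)"
      by simp
    also have "\<dots> = (\<integral>\<^sup>+r. ?i x y r \<partial>R)"
      by (intro nn_integral_cong) (auto simp: indicator_def)
    finally show ?thesis .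
  qed
  have meas: "(\<lambda>(x, y). \<integral>\<^sup>+r. ?i x y r \<partial>R) \<in> borel_measurable (M \<Otimes>\<^sub>M N)"
  proof -
    \<comment> \<open>Reassociating the product makes the pair \<open>w = (x, y)\<close> a single
      parameter, so that measurability of a parametrized integral over \<open>R\<close>
      applies.\<close>
    have "(\<lambda>(w, r). (fst w, snd w, r)) \<in> (M \<Otimes>\<^sub>M N) \<Otimes>\<^sub>M R \<rightarrow>\<^sub>M M \<Otimes>\<^sub>M N \<Otimes>\<^sub>M R"
      by measurable
    from measurable_compose[OF this borel_measurable_indicator[OF B]]
    have "(\<lambda>(w, r). ?i (fst w) (snd w) r) \<in> borel_measurable ((M \<Otimes>\<^sub>M N) \<Otimes>\<^sub>M R)"
      by (simp add: case_prod_unfold)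
    from R.borel_measurable_nn_integral[OF this] show ?thesis
      by (simp add: case_prod_unfold)
  qed
  then show "(\<lambda>(x, y). emeasure R {r \<in> space R. (x, y, r) \<in> B}) \<in> borel_measurable (M \<Otimes>\<^sub>M N)"
    by (rule measurable_cong[THEN iffD1, rotated]) (auto simp: space_pair_measure sect)
  have "(\<integral>\<^sup>+(x, y). emeasure R {r \<in> space R. (x, y, r) \<in> B} \<partial>(M \<Otimes>\<^sub>M N))
      = (\<integral>\<^sup>+(x, y). (\<integral>\<^sup>+r. ?i x y r \<partial>R) \<partial>(M \<Otimes>\<^sub>M N))"
    by (intro nn_integral_cong) (auto simp: space_pair_measure sect)
  \<comment> \<open>The integral over pairs is split into iterated ones; the inner two are then
    merged over \<open>N\<close> and \<open>R\<close>, and finally all three.\<close>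
  also have "\<dots> = (\<integral>\<^sup>+x. \<integral>\<^sup>+y. \<integral>\<^sup>+r. ?i x y r \<partial>R \<partial>N \<partial>M)"
    using N.nn_integral_fst[OF meas] by simp
  also have "\<dots> = (\<integral>\<^sup>+x. \<integral>\<^sup>+z. indicator B (x, z) \<partial>(N \<Otimes>\<^sub>M R) \<partial>M)"
  proof (rule nn_integral_cong)
    fix x assume "x \<in> space M"
    then have "(\<lambda>z. indicator B (x, z) :: ennreal) \<in> borel_measurable (N \<Otimes>\<^sub>M R)"
      by (rule measurable_compose[OF measurable_Pair1' borel_measurable_indicator[OF B]])
    then show "(\<integral>\<^sup>+y. \<integral>\<^sup>+r. ?i x y r \<partial>R \<partial>N) = (\<integral>\<^sup>+z. indicator B (x, z) \<partial>(N \<Otimes>\<^sub>M R))"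
      by (rule R.nn_integral_fst)
  qed
  also have "\<dots> = (\<integral>\<^sup>+w. indicator B w \<partial>(M \<Otimes>\<^sub>M N \<Otimes>\<^sub>M R))"
    using B by (intro NR.nn_integral_fst) simp
  also have "\<dots> = emeasure (M \<Otimes>\<^sub>M N \<Otimes>\<^sub>M R) B"
    using B by simp
  finally show "(\<integral>\<^sup>+(x, y). emeasure R {r \<in> space R. (x, y, r) \<in> B} \<partial>(M \<Otimes>\<^sub>M N))
      = emeasure (M \<Otimes>\<^sub>M N \<Otimes>\<^sub>M R) B" .
qed

theorem theorem1:
  fixes \<rho> :: real and n :: nat
    and X :: "'x measure" and H :: "('x \<Rightarrow> bool) measure" and R :: "'r measure"
    and A :: "(nat \<Rightarrow> 'x \<times> bool) \<Rightarrow> 'r \<Rightarrow> ('x \<Rightarrow> bool)"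
  assumes "0 \<le> \<rho>" and "\<rho> \<le> 1"
    and "learning_algorithm n X H R A"
    and "replicable n \<rho> X R A"
  shows "tv_indistinguishable n \<rho> X (learning_rule H R A)"
  unfolding tv_indistinguishable_def
proof (intro allI impI)
  fix D assume D: "example_distribution X D"
  let ?I = "iid n D"
  let ?P = "?I \<Otimes>\<^sub>M ?I \<Otimes>\<^sub>M R"
  let ?Z = "{(S, S', r) \<in> space ?P. A S r \<noteq> A S' r}"
  have "prob_space D" and sets_D: "sets D = sets (examples X)"
    using D by (auto simp: example_distribution_def)
  \<comment> \<open>Measurability of \<open>A S\<close> is given for samples in the space built from
    \<open>examples X\<close>; equal sigma-algebras carry it over to samples from
    \<open>D\<close>.\<close>
  have space_I: "space ?I = space (iid n (examples X))"
    using sets_eq_imp_space_eq[OF sets_D] by (simp add: space_PiM)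
  interpret R: prob_space R
    using assms(3) by (simp add: learning_algorithm_def)
  interpret I: prob_space ?I
    using \<open>prob_space D\<close> by (rule prob_space_PiM)
  have A: "A S \<in> R \<rightarrow>\<^sub>M H" if "S \<in> space ?I" for S
    using assms(3) that by (simp add: learning_algorithm_def space_I)
  have "?Z \<subseteq> space ?P"
    by auto
  from outer_measure_of_attain[OF this]
  obtain B where B: "B \<in> sets ?P" "?Z \<subseteq> B" "outer_measure_of ?P ?Z = emeasure ?P B"
    by (elim bexE conjE)
  let ?B = "\<lambda>S S'. {r \<in> space R. (S, S', r) \<in> B}"
  have le: "ennreal (tv_dist (learning_rule H R A S) (learning_rule H R A S')) \<le> emeasure R (?B S S')"
    if S: "S \<in> space ?I" "S' \<in> space ?I" for S S'
  proof -
    have "?B S S' \<in> sets R"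
      using B(1) S by (rule sets_section)
    moreover have "r \<in> ?B S S'" if "r \<in> space R" "A S r \<noteq> A S' r" for r
      using S that B(2) by (auto simp: space_pair_measure)
    ultimately show ?thesis
      unfolding learning_rule_def R.emeasure_eq_measure
      by (intro ennreal_leI tv_dist_distr_le_coupling A S R.prob_space_axioms)
  qed
  note sf = R.sigma_finite_measure_axioms I.sigma_finite_measure_axioms
  \<comment> \<open>By \<open>le\<close>, the section probability is one of the measurable majorants
    over which the upper integral takes its infimum.\<close>
  have "upper_nn_integral (?I \<Otimes>\<^sub>M ?I)
        (\<lambda>(S, S'). ennreal (tv_dist (learning_rule H R A S) (learning_rule H R A S')))
      \<le> (\<integral>\<^sup>+(S, S'). emeasure R (?B S S') \<partial>(?I \<Otimes>\<^sub>M ?I))"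
    unfolding upper_nn_integral_def
    using le borel_measurable_emeasure_section[OF sf B(1)]
    by (intro INF_lower) (auto simp: space_pair_measure)
  \<comment> \<open>Averaging the sections recovers the measure of \<open>B\<close>, which was
    chosen to attain the outer measure of \<open>?Z\<close>, so nothing is lost.\<close>
  also have "\<dots> = outer_measure_of ?P ?Z"
    using nn_integral_emeasure_section[OF sf B(1)] B(3) by simp
  also have "\<dots> \<le> ennreal \<rho>"
    using assms(4) D by (simp add: replicable_def Let_def)
  finally show "upper_nn_integral (?I \<Otimes>\<^sub>M ?I)
      (\<lambda>(S, S'). ennreal (tv_dist (learning_rule H R A S) (learning_rule H R A S'))) \<le> ennreal \<rho>" .
qed

end
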